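(* Let $\phi:\mathbb{R}\to\mathbb{R}$ be strictly increasing, $m,\ell\ge1$, and let $\mathscr{U}$ be a nonempty set of triples $(\mathbf{x},\mathbf{y},\mathbf{z})$ with $\mathbf{y},\mathbf{z}\in\mathbb{R}^m$, all $z_j\neq0$. For each $j\in\{1,\dots,m\}$ let $\mathscr{D}_j=\{y_j/z_j:(\mathbf{x},\mathbf{y},\mathbf{z})\in\mathscr{U}\}$, assumed bounded with $\inf\mathscr{D}_j<\sup\mathscr{D}_j$. Set $b_{j0}^*=\inf\mathscr{D}_j$, $b_{j\ell}^*=\sup\mathscr{D}_j$, $$\varepsilon_j=\frac{\phi(b_{j\ell}^* )-\phi(b_{j0}^* )}{\ell},\qquad b_{jk}^*=\phi^{-1}\left(\phi(b_{j0}^* )+k\varepsilon_j\right)\quad(k=0,\dots,\ell),$$ where it is assumed that the values $\phi(b_{j0}^* )+k\varepsilon_j$ lie in the range of $\phi$. Then the breakpoints $\{b_{jk}^*\}$ (which distribute evenly over the range of $\phi$) minimize the maximum error of the stepwise approximation: for every choice, for each $j$, of an increasing sequence of breakpoints $b_{j0}<b_{j1}<\dots<b_{j\ell}$ with $\mathscr{D}_j\subseteq[b_{j0},b_{j\ell}]$, $$\sum_{j=1}^m\max_{k\in\{1,\dots,\ell\}}\{\phi(b_{jk}^* )-\phi(b_{j,k-1}^* )\}\ \le\ \sum_{j=1}^m\max_{k\in\{1,\dots,\ell\}}\{\phi(b_{jk})-\phi(b_{j,k-1})\}.$$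
   Context: In the stepwise approximation of $\sum_{j=1}^m\phi(y_j/z_j)$ with breakpoints $\{b_{jk}\}$, the term $\phi(y_j/z_j)$ is replaced by $\phi(b_{j\bar k})$ with $b_{j\bar k}$ the smallest breakpoint greater than $y_j/z_j$; its maximum error is by definition $\sum_{j=1}^m\max_{k\in\{1,\dots,\ell\}}\{\phi(b_{jk})-\phi(b_{j,k-1})\}$. *)

theory Defs
  imports "HOL-Analysis.Analysis"
begin

definition ratio_set :: "('x \<times> (real ^ 'm) \<times> (real ^ 'm)) set \<Rightarrow> 'm \<Rightarrow> real set" where
  "ratio_set U j = {y $ j / z $ j | x y z. (x, y, z) \<in> U}"

definition eps :: "(real \<Rightarrow> real) \<Rightarrow> nat \<Rightarrow> real set \<Rightarrow> real" where
  "eps \<phi> l D = (\<phi> (Sup D) - \<phi> (Inf D)) / real l"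

text \<open>
  The inverse is the total choice inverse on the reals; it is the genuine inverse only at arguments
  in the range of the injective function \<open>\<phi>\<close>.  The two end points need no separate clause:
  see \<open>even_breakpoint_0\<close> and \<open>even_breakpoint_last\<close>.
\<close>
definition even_breakpoint :: "(real \<Rightarrow> real) \<Rightarrow> nat \<Rightarrow> real set \<Rightarrow> nat \<Rightarrow> real" where
  "even_breakpoint \<phi> l D k = inv \<phi> (\<phi> (Inf D) + real k * eps \<phi> l D)"

lemma even_breakpoint_0:
  assumes "strict_mono \<phi>"
  shows "even_breakpoint \<phi> l D 0 = Inf D"
  using assms by (simp add: even_breakpoint_def strict_mono_imp_inj_on inv_f_f)

lemma even_breakpoint_last:
  assumes "strict_mono \<phi>" "1 \<le> l"
  shows "even_breakpoint \<phi> l D l = Sup D"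
  using assms by (simp add: even_breakpoint_def eps_def strict_mono_imp_inj_on inv_f_f)

definition admissible_breakpoints :: "nat \<Rightarrow> real set \<Rightarrow> (nat \<Rightarrow> real) \<Rightarrow> bool" where
  "admissible_breakpoints l D b \<longleftrightarrow> strict_mono_on {0..l} b \<and> D \<subseteq> {b 0..b l}"

definition max_error :: "(real \<Rightarrow> real) \<Rightarrow> nat \<Rightarrow> ('m::finite \<Rightarrow> nat \<Rightarrow> real) \<Rightarrow> real" where
  "max_error \<phi> l b = (\<Sum>j\<in>UNIV. Max ((\<lambda>k. \<phi> (b j k) - \<phi> (b j (k - 1))) ` {1..l}))"

end

theory Submission
  imports Defs
begin

text \<open>
  The problem separates over \<open>j\<close>, so a single ratio set \<open>D\<close> may be fixed.  The increments
  \<open>\<phi> (b k) - \<phi> (b (k - 1))\<close> of any breakpoint sequence telescope to \<open>\<phi> (b l) - \<phi> (b 0)\<close>, and the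
  largest of \<open>l\<close> numbers is at least their mean (\<open>mean_increment_le_Max\<close>).  Since an admissible
  sequence encloses \<open>D\<close>, and hence \<open>Inf D\<close> and \<open>Sup D\<close>, monotonicity of \<open>\<phi>\<close> makes that mean at
  least \<open>eps \<phi> l D\<close> (\<open>eps_le_max_increment\<close>).  The even breakpoints attain this lower bound, because
  all their increments are equal to \<open>eps \<phi> l D\<close> (\<open>even_breakpoint_max_increment\<close>).
\<close>

lemma mean_increment_le_Max:
  fixes f :: "nat \<Rightarrow> real"
  assumes "1 \<le> l"
  shows "(f l - f 0) / real l \<le> Max ((\<lambda>k. f k - f (k - 1)) ` {1..l})" (is "_ \<le> ?M")
proof -
  have "f l - f 0 = (\<Sum>k\<in>{1..l}. f k - f (k - 1))"
    using sum_telescope''[of 0 l f] by simp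
  also have "\<dots> \<le> real (card {1..l}) * ?M"
    by (rule sum_bounded_above) (auto intro: Max_ge)
  finally show ?thesis
    using assms by (simp add: field_simps)
qed

text \<open>
  Enclosing \<open>D\<close> forces \<open>b 0 \<le> Inf D\<close> and \<open>Sup D \<le> b l\<close>, so the values of \<open>\<phi>\<close> along \<open>b\<close> climb at
  least as far as from \<open>\<phi> (Inf D)\<close> to \<open>\<phi> (Sup D)\<close>, and they do so in \<open>l\<close> steps.
\<close>
lemma eps_le_max_increment:
  assumes "mono \<phi>" "1 \<le> l" "D \<noteq> {}" "D \<subseteq> {b 0..b l}"
  shows "eps \<phi> l D \<le> Max ((\<lambda>k. \<phi> (b k) - \<phi> (b (k - 1))) ` {1..l})"
proof -
  have "b 0 \<le> Inf D"
    by (rule cInf_greatest) (use assms(3,4) in auto)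
  moreover have "Sup D \<le> b l"
    by (rule cSup_least) (use assms(3,4) in auto)
  ultimately have "\<phi> (Sup D) - \<phi> (Inf D) \<le> \<phi> (b l) - \<phi> (b 0)"
    using \<open>mono \<phi>\<close> by (intro diff_mono) (auto dest: monoD)
  hence "eps \<phi> l D \<le> (\<phi> (b l) - \<phi> (b 0)) / real l"
    unfolding eps_def by (rule divide_right_mono) simp
  also have "\<dots> \<le> Max ((\<lambda>k. \<phi> (b k) - \<phi> (b (k - 1))) ` {1..l})"
    using mean_increment_le_Max[OF \<open>1 \<le> l\<close>, of "\<lambda>k. \<phi> (b k)"] by simp
  finally show ?thesis .
qed

lemma phi_even_breakpoint:
  assumes "\<phi> (Inf D) + real k * eps \<phi> l D \<in> range \<phi>"
  shows "\<phi> (even_breakpoint \<phi> l D k) = \<phi> (Inf D) + real k * eps \<phi> l D"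
  using assms by (simp add: even_breakpoint_def f_inv_into_f)

lemma even_breakpoint_max_increment:
  assumes "1 \<le> l"
    and range: "\<And>k. k \<le> l \<Longrightarrow> \<phi> (Inf D) + real k * eps \<phi> l D \<in> range \<phi>"
  shows "Max ((\<lambda>k. \<phi> (even_breakpoint \<phi> l D k) - \<phi> (even_breakpoint \<phi> l D (k - 1))) ` {1..l})
           = eps \<phi> l D"
proof -
  have "\<phi> (even_breakpoint \<phi> l D k) - \<phi> (even_breakpoint \<phi> l D (k - 1)) = eps \<phi> l D"
    if "k \<in> {1..l}" for k
  proof -
    from that have "k \<le> l" "k - 1 \<le> l" and real_pred: "real (k - 1) = real k - 1"
      by auto
    thus ?thesis
      unfolding phi_even_breakpoint[OF range[OF \<open>k \<le> l\<close>]]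
        phi_even_breakpoint[OF range[OF \<open>k - 1 \<le> l\<close>]] real_pred
      by (simp add: algebra_simps)
  qed
  hence "(\<lambda>k. \<phi> (even_breakpoint \<phi> l D k) - \<phi> (even_breakpoint \<phi> l D (k - 1))) ` {1..l}
           = (\<lambda>k. eps \<phi> l D) ` {1..l}"
    by (rule image_cong[OF refl])
  thus ?thesis
    using \<open>1 \<le> l\<close> by (simp add: image_constant_conv)
qed

text \<open>
  The images of the even breakpoints under \<open>\<phi>\<close> form an arithmetic progression with positive
  difference, and a strictly increasing \<open>\<phi>\<close> reflects the strict order of its values.
\<close>
lemma even_breakpoint_admissible:
  assumes "strict_mono \<phi>" "1 \<le> l" "bounded D" "Inf D < Sup D"
    and range: "\<And>k. k \<le> l \<Longrightarrow> \<phi> (Inf D) + real k * eps \<phi> l D \<in> range \<phi>"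
  shows "admissible_breakpoints l D (even_breakpoint \<phi> l D)"
  unfolding admissible_breakpoints_def
proof
  have "0 < eps \<phi> l D"
    using assms(1,2,4) by (simp add: eps_def strict_mono_less)
  hence "\<phi> (even_breakpoint \<phi> l D i) < \<phi> (even_breakpoint \<phi> l D k)" if "i < k" "k \<le> l" for i k
    using that by (simp add: phi_even_breakpoint range)
  thus "strict_mono_on {0..l} (even_breakpoint \<phi> l D)"
    using \<open>strict_mono \<phi>\<close> by (auto simp: strict_mono_on_def strict_mono_less)
next
  have "D \<subseteq> {Inf D..Sup D}"
    using bounded_imp_bdd_below[OF \<open>bounded D\<close>] bounded_imp_bdd_above[OF \<open>bounded D\<close>]
    by (auto intro: cInf_lower cSup_upper)
  thus "D \<subseteq> {even_breakpoint \<phi> l D 0..even_breakpoint \<phi> l D l}"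
    using assms(1,2) by (simp add: even_breakpoint_0 even_breakpoint_last)
qed

theorem proposition8:
  fixes \<phi> :: "real \<Rightarrow> real"
    and l :: nat
    and U :: "('x \<times> (real ^ 'm) \<times> (real ^ 'm)) set"
  assumes "strict_mono \<phi>"
    and "1 \<le> l"
    and "U \<noteq> {}"
    and "\<And>x y z j. (x, y, z) \<in> U \<Longrightarrow> z $ j \<noteq> 0"
    and "\<And>j. bounded (ratio_set U j)"
    and "\<And>j. Inf (ratio_set U j) < Sup (ratio_set U j)"
    and "\<And>j k. k \<le> l \<Longrightarrow>
           \<phi> (Inf (ratio_set U j)) + real k * eps \<phi> l (ratio_set U j) \<in> range \<phi>"
  shows "(\<forall>j. admissible_breakpoints l (ratio_set U j) (even_breakpoint \<phi> l (ratio_set U j))) \<and>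
         (\<forall>b. (\<forall>j. admissible_breakpoints l (ratio_set U j) (b j)) \<longrightarrow>
              max_error \<phi> l (\<lambda>j. even_breakpoint \<phi> l (ratio_set U j)) \<le> max_error \<phi> l b)"
proof (intro conjI allI impI)
  fix j
  show "admissible_breakpoints l (ratio_set U j) (even_breakpoint \<phi> l (ratio_set U j))"
    by (rule even_breakpoint_admissible) (use assms in auto)
next
  fix b
  assume adm: "\<forall>j. admissible_breakpoints l (ratio_set U j) (b j)"
  have "ratio_set U j \<noteq> {}" for j
    using \<open>U \<noteq> {}\<close> by (auto simp: ratio_set_def)
  hence "eps \<phi> l (ratio_set U j) \<le> Max ((\<lambda>k. \<phi> (b j k) - \<phi> (b j (k - 1))) ` {1..l})" for j
    using adm assms(1,2)
    by (intro eps_le_max_increment) (auto simp: admissible_breakpoints_def strict_mono_mono)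
  thus "max_error \<phi> l (\<lambda>j. even_breakpoint \<phi> l (ratio_set U j)) \<le> max_error \<phi> l b"
    unfolding max_error_def
    by (intro sum_mono) (simp only: even_breakpoint_max_increment[OF assms(2) assms(7)])
qed

end
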